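(* Given a degenerate conditionally optimal lower bound on $\Omega$ based on a total order $T$, there exists another conditionally optimal bound, based on another total order $T'$, that dominates it. Hence, no degenerate bound is admissible.
   Context: Fix a finite nonempty set $S$ of non-negative reals with least element $0$, an integer $n\ge 1$ and $\alpha\in(0,1)$ (the confidence level is $1-\alpha$). The sample space is $\Omega=\Omega(S,n)=\{(x_1,\dots,x_n)\in S^n: x_1\le\dots\le x_n\}$, with $N=|\Omega|$; $\mathbf{0}=(0,\dots,0)\in\Omega$. $\mathcal{F}=\mathcal{F}(S)$ is the closed simplex of all probability distributions on $S$ (zero masses allowed), with the Euclidean topology on mass vectors, and $\mu(F)=\sum_{s\in S}sF(s)$. For $x\in\Omega$ containing $\hat x_s$ copies of $s$, $\Pr_F(x)=\frac{n!}{\prod_{s}\hat x_s!}\prod_{s\in S}F(s)^{\hat x_s}$ (with $0^0=1$), and $\Pr_F(A)=\sum_{x\in A}\Pr_F(x)$ for $A\subseteq\Omega$. A lower bound is any map $B:\Omega\to[-\infty,\infty]$. It is valid if $\Pr_F(\{x\in\Omega: B(x)>\mu(F)\})\le\alpha$ for every $F\in\mathcal{F}$. For valid bounds, $B_1$ dominates $B_2$ if $B_1(x)\ge B_2(x)$ for all $x\in\Omega$ with strict inequality for at least one $x$. A bound $B$ is admissible if it is valid and no valid bound dominates it. A total order $T$ on $\Omega$ is an enumeration $(x_{t_1},\dots,x_{t_N})$ of $\Omega$; a bound $B$ is consistent with $T$ if $B(x_{t_1})\le\dots\le B(x_{t_N})$. The conditionally optimal bound $B_T^*$ for (based on) $T$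 is the (unique) valid bound consistent with $T$ that dominates every other valid bound consistent with $T$. Classically (Buehler) it exists and is given by $B_T^*(x_{t_k})=\min_{F\in\mathcal{F}_k}\mu(F)$ if $\mathcal{F}_k\neq\emptyset$ and $B_T^*(x_{t_k})=\infty$ if $\mathcal{F}_k=\emptyset$, where $\Omega_k=\{x_{t_k},\dots,x_{t_N}\}$ and $\mathcal{F}_k$ is the closure of $\{F\in\mathcal{F}:\Pr_F(\Omega_k)>\alpha\}$. A total order $T$, and the conditionally optimal bound based on it, are called degenerate if the first element $x_{t_1}$ of $T$ is not $\mathbf{0}$. *)

theory Defs
  imports "HOL-Probability.Probability"
begin

definition samples :: "real set \<Rightarrow> nat \<Rightarrow> real list set" where
  "samples S n = {x. length x = n \<and> set x \<subseteq> S \<and> sorted x}"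

definition distributions :: "real set \<Rightarrow> real pmf set" where
  "distributions S = {F. set_pmf F \<subseteq> S}"

definition mean :: "real set \<Rightarrow> real pmf \<Rightarrow> real" where
  "mean S F = (\<Sum>s\<in>S. s * pmf F s)"

text \<open>A sorted sample stands for all its rearrangements, hence the multinomial coefficient.\<close>

definition sample_prob :: "real set \<Rightarrow> nat \<Rightarrow> real pmf \<Rightarrow> real list \<Rightarrow> real" where
  "sample_prob S n F x =
     fact n / (\<Prod>s\<in>S. fact (count_list x s)) * (\<Prod>s\<in>S. pmf F s ^ count_list x s)"

definition event_prob :: "real set \<Rightarrow> nat \<Rightarrow> real pmf \<Rightarrow> real list set \<Rightarrow> real" where
  "event_prob S n F A = (\<Sum>x\<in>A. sample_prob S n F x)"

text \<open>Bounds are extensional functions, so that equality of bounds is equality on the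
  sample space.\<close>

definition lower_bounds :: "real set \<Rightarrow> nat \<Rightarrow> (real list \<Rightarrow> ereal) set" where
  "lower_bounds S n = samples S n \<rightarrow>\<^sub>E UNIV"

definition valid_bound :: "real set \<Rightarrow> nat \<Rightarrow> real \<Rightarrow> (real list \<Rightarrow> ereal) \<Rightarrow> bool" where
  "valid_bound S n \<alpha> B \<longleftrightarrow>
     B \<in> lower_bounds S n \<and>
     (\<forall>F\<in>distributions S. event_prob S n F {x \<in> samples S n. B x > ereal (mean S F)} \<le> \<alpha>)"

definition dominates ::
    "real set \<Rightarrow> nat \<Rightarrow> (real list \<Rightarrow> ereal) \<Rightarrow> (real list \<Rightarrow> ereal) \<Rightarrow> bool" where
  "dominates S n B1 B2 \<longleftrightarrow>
     (\<forall>x\<in>samples S n. B1 x \<ge> B2 x) \<and> (\<exists>x\<in>samples S n. B1 x > B2 x)"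

definition admissible :: "real set \<Rightarrow> nat \<Rightarrow> real \<Rightarrow> (real list \<Rightarrow> ereal) \<Rightarrow> bool" where
  "admissible S n \<alpha> B \<longleftrightarrow>
     valid_bound S n \<alpha> B \<and> \<not> (\<exists>B'. valid_bound S n \<alpha> B' \<and> dominates S n B' B)"

definition total_orders :: "real set \<Rightarrow> nat \<Rightarrow> real list list set" where
  "total_orders S n = {T. distinct T \<and> set T = samples S n}"

definition consistent :: "real list list \<Rightarrow> (real list \<Rightarrow> ereal) \<Rightarrow> bool" where
  "consistent T B \<longleftrightarrow> sorted (map B T)"

text \<open>At most one \<open>B\<close> satisfies this for given \<open>T\<close>, because \<open>dominates\<close> is asymmetric.\<close>

definition cond_optimal ::
    "real set \<Rightarrow> nat \<Rightarrow> real \<Rightarrow> real list list \<Rightarrow> (real list \<Rightarrow> ereal) \<Rightarrow> bool" where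
  "cond_optimal S n \<alpha> T B \<longleftrightarrow>
     valid_bound S n \<alpha> B \<and> consistent T B \<and>
     (\<forall>B'. valid_bound S n \<alpha> B' \<and> consistent T B' \<and> B' \<noteq> B \<longrightarrow> dominates S n B B')"

definition degenerate_order :: "real set \<Rightarrow> nat \<Rightarrow> real list list \<Rightarrow> bool" where
  "degenerate_order S n T \<longleftrightarrow> T \<in> total_orders S n \<and> hd T \<noteq> replicate n 0"

definition degenerate_bound :: "real set \<Rightarrow> nat \<Rightarrow> real \<Rightarrow> (real list \<Rightarrow> ereal) \<Rightarrow> bool" where
  "degenerate_bound S n \<alpha> B \<longleftrightarrow> (\<exists>T. degenerate_order S n T \<and> cond_optimal S n \<alpha> T B)"

end

theory Submission imports Defs begin

text \<open>
  A sample that is ranked below the zero sample \<open>\<zero>\<close> by a total order cannot receive a positive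
  bound: under the point mass at \<open>0\<close>, whose mean is \<open>0\<close>, the sample \<open>\<zero>\<close> occurs with
  probability \<open>1 > \<alpha>\<close>, so every valid bound is at most \<open>0\<close> at \<open>\<zero>\<close>, and a consistent one is
  then at most \<open>0\<close> at everything ranked before \<open>\<zero>\<close>. In a degenerate order this includes the
  first element \<open>x\<close>.

  Move \<open>\<zero>\<close> to the front, leaving the order otherwise unchanged. Lowering a valid bound at a
  single sample keeps it valid, so the old bound, set to \<open>- \<infinity>\<close> at \<open>\<zero>\<close>, is valid and consistent
  with the new order, and the optimal bound for the new order is at least the old bound away from
  \<open>\<zero>\<close>. At \<open>\<zero>\<close> nothing is lost, since the new optimal bound is an infimum of means and means are
  nonnegative. At \<open>x\<close> there is a strict gain: the new bound at \<open>x\<close> is the infimum of the means of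
  those \<open>F\<close> for which the event of all samples other than \<open>\<zero>\<close> has probability more than \<open>\<alpha>\<close>.
  That probability is at most a constant times the mean of \<open>F\<close>
  (\<open>event_prob_le_const_times_mean\<close>), so the infimum is positive.

  The optimal bound for the new order is Buehler's bound (\<open>cond_optimal_buehler_bound\<close>): at
  each sample it is the infimum of all means that a consistent bound must not exceed there in order
  to be valid, and this infimum is itself valid and consistent.
\<close>

section \<open>Sample probabilities and validity\<close>

lemma finite_samples: "finite S \<Longrightarrow> finite (samples S n)"
  unfolding samples_def
  by (rule finite_subset[OF _ finite_lists_length_eq[of S n]]) auto

lemma sample_prob_nonneg: "0 \<le> sample_prob S n F x"
  unfolding sample_prob_def by (intro mult_nonneg_nonneg divide_nonneg_nonneg prod_nonneg) auto

lemma event_prob_mono: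
  assumes "finite B" and "A \<subseteq> B"
  shows "event_prob S n F A \<le> event_prob S n F B"
  unfolding event_prob_def using assms by (intro sum_mono2) (auto simp: sample_prob_nonneg)

lemma mean_nonneg: "\<forall>s\<in>S. 0 \<le> s \<Longrightarrow> 0 \<le> mean S F"
  unfolding mean_def by (intro sum_nonneg mult_nonneg_nonneg) auto

lemma mean_return_zero: "mean S (return_pmf 0) = 0"
  unfolding mean_def by (intro sum.neutral) (auto simp: indicator_def)

lemma zero_sample: "0 \<in> S \<Longrightarrow> replicate n 0 \<in> samples S n"
  by (auto simp: samples_def)

lemma count_list_replicate: "count_list (replicate n x) y = (if x = y then n else 0)"
  by (induction n) auto

lemma sample_prob_return_zero:
  assumes "finite S" and "0 \<in> S"
  shows "sample_prob S n (return_pmf 0) (replicate n 0) = 1"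
proof -
  have "(\<Prod>s\<in>S. fact (count_list (replicate n 0) s) :: real) = fact n"
    using assms by (subst prod.remove[of S 0]) (auto simp: count_list_replicate)
  moreover have "(\<Prod>s\<in>S. pmf (return_pmf 0) s ^ count_list (replicate n 0) s) = (1 :: real)"
    by (intro prod.neutral) (auto simp: count_list_replicate pmf_return)
  ultimately show ?thesis by (simp add: sample_prob_def)
qed

lemma valid_bound_zero_sample_le:
  assumes "finite S" and "0 \<in> S" and "\<alpha> < 1" and "valid_bound S n \<alpha> B"
  shows "B (replicate n 0) \<le> 0"
proof (rule ccontr)
  assume "\<not> B (replicate n 0) \<le> 0"
  then have "{replicate n 0} \<subseteq> {x \<in> samples S n. B x > ereal (mean S (return_pmf 0))}"
    using zero_sample[OF assms(2)] by (auto simp: mean_return_zero zero_ereal_def)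
  then have "event_prob S n (return_pmf 0) {replicate n 0}
      \<le> event_prob S n (return_pmf 0) {x \<in> samples S n. B x > ereal (mean S (return_pmf 0))}"
    by (rule event_prob_mono[rotated]) (simp add: finite_samples assms(1))
  also have "\<dots> \<le> \<alpha>"
    using assms(2,4) by (auto simp: valid_bound_def distributions_def)
  finally show False
    using assms by (simp add: event_prob_def sample_prob_return_zero)
qed

text \<open>Every valid bound is at most the mean of \<open>F\<close> outside an event of small probability; lowering
  it only shrinks the event that has to be small.\<close>

lemma valid_bound_anti_mono:
  assumes "finite S" and "valid_bound S n \<alpha> B" and "B' \<in> lower_bounds S n"
    and "\<And>x. x \<in> samples S n \<Longrightarrow> B' x \<le> B x"
  shows "valid_bound S n \<alpha> B'"
proof -
  have "event_prob S n F {x \<in> samples S n. B' x > ereal (mean S F)}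
      \<le> event_prob S n F {x \<in> samples S n. B x > ereal (mean S F)}" for F
  proof (intro event_prob_mono Collect_mono impI)
    fix x assume "x \<in> samples S n \<and> ereal (mean S F) < B' x"
    then show "x \<in> samples S n \<and> ereal (mean S F) < B x"
      using assms(4)[of x] by (auto elim: less_le_trans)
  qed (simp add: finite_samples assms(1))
  then show ?thesis
    using assms(2,3) unfolding valid_bound_def by (blast intro: order_trans)
qed

section \<open>Nonzero samples are improbable when the mean is small\<close>

text \<open>A nonzero sample contains some \<open>s > 0\<close>, so its probability carries a factor \<open>F(s)\<close>, and
  \<open>s F(s)\<close> is one of the summands of the mean.\<close>

lemma sample_prob_le_const_times_mean:
  assumes "finite S" and "\<forall>s\<in>S. 0 \<le> s" and "x \<in> samples S n" and "x \<noteq> replicate n 0"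
  shows "\<exists>C\<ge>0. \<forall>F. sample_prob S n F x \<le> C * mean S F"
proof -
  obtain s where s: "s \<in> set x" "s \<noteq> 0"
    using assms(3,4) replicate_eqI[of x n 0] by (auto simp: samples_def)
  then have sS: "s \<in> S" and pos: "0 < s"
    using assms(2,3) by (auto simp: samples_def less_le)
  have "sample_prob S n F x \<le> fact n / s * mean S F" for F
  proof -
    have "(\<Prod>t\<in>S. pmf F t ^ count_list x t)
        = pmf F s ^ count_list x s * (\<Prod>t\<in>S - {s}. pmf F t ^ count_list x t)"
      by (rule prod.remove[OF assms(1) sS])
    also have "\<dots> \<le> pmf F s ^ 1 * 1"
    proof (intro mult_mono)
      show "pmf F s ^ count_list x s \<le> pmf F s ^ 1"
        using s by (intro power_decreasing) (auto simp: pmf_le_1 Suc_le_eq count_list_0_iff intro!: gr0I)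
    qed (auto intro!: prod_le_1 prod_nonneg power_le_one simp: pmf_le_1)
    finally have prod_le: "(\<Prod>t\<in>S. pmf F t ^ count_list x t) \<le> pmf F s" by simp
    have "1 \<le> (\<Prod>t\<in>S. fact (count_list x t) :: real)"
      by (intro prod_ge_1) simp
    then have "fact n / (\<Prod>t\<in>S. fact (count_list x t)) \<le> (fact n :: real)"
      by (simp add: divide_le_eq mult_le_cancel_left1)
    then have "sample_prob S n F x \<le> fact n * pmf F s"
      unfolding sample_prob_def using prod_le
      by (intro mult_mono) (auto intro: prod_nonneg)
    also have "\<dots> = fact n / s * (s * pmf F s)"
      using pos by simp
    also have "\<dots> \<le> fact n / s * mean S F"
      unfolding mean_def using pos assms(1,2) sS
      by (intro mult_left_mono member_le_sum) auto
    finally show ?thesis .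
  qed
  then show ?thesis using pos by (intro exI[of _ "fact n / s"]) auto
qed

lemma event_prob_le_const_times_mean:
  assumes "finite S" and "\<forall>s\<in>S. 0 \<le> s" and "A \<subseteq> samples S n - {replicate n 0}"
  shows "\<exists>C>0. \<forall>F. event_prob S n F A \<le> C * mean S F"
proof -
  have "\<forall>x\<in>A. \<exists>C\<ge>0. \<forall>F. sample_prob S n F x \<le> C * mean S F"
    using sample_prob_le_const_times_mean[OF assms(1,2)] assms(3) by blast
  then obtain C where C: "\<And>x. x \<in> A \<Longrightarrow> 0 \<le> C x"
      "\<And>x F. x \<in> A \<Longrightarrow> sample_prob S n F x \<le> C x * mean S F"
    by metis
  \<comment> \<open>The summand \<open>1\<close> keeps the constant positive when \<open>A\<close> is empty.\<close>
  have "event_prob S n F A \<le> (1 + sum C A) * mean S F" for F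
  proof -
    have "event_prob S n F A \<le> (\<Sum>x\<in>A. C x * mean S F)"
      unfolding event_prob_def by (intro sum_mono C(2))
    also have "\<dots> \<le> (1 + sum C A) * mean S F"
      using mean_nonneg[OF assms(2)] by (simp add: sum_distrib_right distrib_right)
    finally show ?thesis .
  qed
  moreover have "0 < 1 + sum C A"
    using sum_nonneg[of A C] C(1) by simp
  ultimately show ?thesis by blast
qed

section \<open>Buehler's bound\<close>

lemma in_set_drop_conv_nth:
  "x \<in> set (drop i xs) \<longleftrightarrow> (\<exists>j. i \<le> j \<and> j < length xs \<and> x = xs ! j)"
proof
  assume "x \<in> set (drop i xs)"
  then obtain k where "k < length xs - i" "x = xs ! (i + k)"
    by (auto simp: in_set_conv_nth)
  then show "\<exists>j. i \<le> j \<and> j < length xs \<and> x = xs ! j"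
    by (intro exI[of _ "i + k"]) auto
next
  assume "\<exists>j. i \<le> j \<and> j < length xs \<and> x = xs ! j"
  then obtain j where "i \<le> j" "j < length xs" "x = xs ! j" by blast
  then show "x \<in> set (drop i xs)"
    unfolding in_set_conv_nth by (intro exI[of _ "j - i"]) auto
qed

definition upper_set :: "'a list \<Rightarrow> 'a \<Rightarrow> 'a set" where
  "upper_set T x = set (dropWhile (\<lambda>y. y \<noteq> x) T)"

lemma upper_set_nth:
  assumes "distinct T" and "i < length T"
  shows "upper_set T (T ! i) = set (drop i T)"
  unfolding upper_set_def using assms
proof (induction T arbitrary: i)
  case (Cons y T)
  then show ?case by (cases i) auto
qed simp

text \<open>Buehler's bound as an infimum over the distributions with
  \<open>Pr\<^sub>F(\<Omega>\<^sub>k) > \<alpha>\<close> themselves: the mean is continuous, so this is the minimum over their closure,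
  and the infimum of the empty set is \<open>\<infinity>\<close> as required.\<close>

definition buehler_bound ::
    "real set \<Rightarrow> nat \<Rightarrow> real \<Rightarrow> real list list \<Rightarrow> real list \<Rightarrow> ereal" where
  "buehler_bound S n \<alpha> T =
     (\<lambda>x\<in>samples S n. INF F\<in>{F \<in> distributions S. \<alpha> < event_prob S n F (upper_set T x)}.
        ereal (mean S F))"

text \<open>Let \<open>T ! i\<close> be the first sample at which the bound exceeds the mean of \<open>F\<close>. The event of
  exceeding lies in the upper set of \<open>T ! i\<close>; were it more probable than \<open>\<alpha>\<close>, then \<open>F\<close> would take
  part in the infimum at \<open>T ! i\<close>.\<close>

lemma valid_buehler_bound:
  assumes "finite S" and "0 < \<alpha>" and "T \<in> total_orders S n"
  shows "valid_bound S n \<alpha> (buehler_bound S n \<alpha> T)"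
  unfolding valid_bound_def
proof (intro conjI ballI)
  show "buehler_bound S n \<alpha> T \<in> lower_bounds S n"
    by (auto simp: buehler_bound_def lower_bounds_def)
next
  fix F assume F: "F \<in> distributions S"
  let ?U = "{x \<in> samples S n. buehler_bound S n \<alpha> T x > ereal (mean S F)}"
  have T: "distinct T" "set T = samples S n"
    using assms(3) by (auto simp: total_orders_def)
  show "event_prob S n F ?U \<le> \<alpha>"
  proof (cases "?U = {}")
    case True
    then show ?thesis using assms(2) unfolding event_prob_def by (subst True) simp
  next
    case False
    let ?P = "\<lambda>i. i < length T \<and> T ! i \<in> ?U"
    define i where "i = (LEAST i. ?P i)"
    obtain x where x: "x \<in> ?U" using False by blast
    then have "x \<in> set T" by (simp add: T(2))
    then have "\<exists>i. ?P i"
      unfolding in_set_conv_nth using x by blast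
    then have i: "?P i" unfolding i_def by (rule LeastI_ex)
    have "?U \<subseteq> upper_set T (T ! i)"
    proof
      fix y assume y: "y \<in> ?U"
      then have "y \<in> set T" by (simp add: T(2))
      then obtain j where j: "j < length T" "y = T ! j"
        by (auto simp only: in_set_conv_nth)
      then have "i \<le> j" using y unfolding i_def by (intro Least_le) simp
      then have "y \<in> set (drop i T)"
        using j unfolding in_set_drop_conv_nth by blast
      then show "y \<in> upper_set T (T ! i)" using upper_set_nth[OF T(1)] i by simp
    qed
    then have "event_prob S n F ?U \<le> event_prob S n F (upper_set T (T ! i))"
      by (intro event_prob_mono) (auto simp: upper_set_def)
    also have "\<dots> \<le> \<alpha>"
    proof (rule ccontr)
      assume "\<not> ?thesis"
      then have "buehler_bound S n \<alpha> T (T ! i) \<le> ereal (mean S F)"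
        using i F by (auto simp: buehler_bound_def intro!: INF_lower)
      then show False using i by auto
    qed
    finally show ?thesis .
  qed
qed

lemma consistent_buehler_bound:
  assumes "T \<in> total_orders S n"
  shows "consistent T (buehler_bound S n \<alpha> T)"
  unfolding consistent_def
proof (rule sorted_iff_nth_mono[THEN iffD2], intro allI impI)
  fix i j assume ij: "i \<le> j" "j < length (map (buehler_bound S n \<alpha> T) T)"
  have T: "distinct T" "set T = samples S n"
    using assms by (auto simp: total_orders_def)
  have sub: "upper_set T (T ! j) \<subseteq> upper_set T (T ! i)"
    using ij T(1) by (simp add: upper_set_nth set_drop_subset_set_drop)
  have "event_prob S n F (upper_set T (T ! j)) \<le> event_prob S n F (upper_set T (T ! i))" for F
    by (intro event_prob_mono sub) (simp add: upper_set_def)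
  then have "{F \<in> distributions S. \<alpha> < event_prob S n F (upper_set T (T ! j))}
      \<subseteq> {F \<in> distributions S. \<alpha> < event_prob S n F (upper_set T (T ! i))}"
    by (intro Collect_mono) (metis less_le_trans)
  moreover have "T ! i \<in> samples S n" "T ! j \<in> samples S n"
    using ij nth_mem[of i T] nth_mem[of j T] by (simp_all add: T(2))
  ultimately have "buehler_bound S n \<alpha> T (T ! i) \<le> buehler_bound S n \<alpha> T (T ! j)"
    unfolding buehler_bound_def by (simp only: restrict_apply' INF_superset_mono order_refl)
  then show "map (buehler_bound S n \<alpha> T) T ! i \<le> map (buehler_bound S n \<alpha> T) T ! j"
    using ij by simp
qed

text \<open>If a consistent bound exceeds the mean of \<open>F\<close> at \<open>x\<close>, it does so on the whole upper set of
  \<open>x\<close>; for a valid bound that set then has probability at most \<open>\<alpha>\<close> under \<open>F\<close>.\<close>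

lemma valid_consistent_le_buehler_bound:
  assumes "finite S" and "T \<in> total_orders S n"
    and "valid_bound S n \<alpha> B" and "consistent T B" and "x \<in> samples S n"
  shows "B x \<le> buehler_bound S n \<alpha> T x"
proof -
  have T: "distinct T" "set T = samples S n"
    using assms(2) by (auto simp: total_orders_def)
  obtain i where i: "i < length T" "x = T ! i"
    using assms(5) T(2) by (metis in_set_conv_nth)
  have above: "B x \<le> B y" if y: "y \<in> upper_set T x" for y
  proof -
    obtain j where "i \<le> j" "j < length T" "y = T ! j"
      using y i upper_set_nth[OF T(1)] by (auto simp: in_set_drop_conv_nth)
    then show ?thesis
      using assms(4) i sorted_nth_mono[of "map B T" i j] by (simp add: consistent_def)
  qed
  have "B x \<le> ereal (mean S F)"
    if F: "F \<in> distributions S" "\<alpha> < event_prob S n F (upper_set T x)" for F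
  proof (rule ccontr)
    assume "\<not> ?thesis"
    then have "upper_set T x \<subseteq> {y \<in> samples S n. B y > ereal (mean S F)}"
      using above T(2) by (auto simp: upper_set_def not_le dest: set_dropWhileD elim: less_le_trans)
    then have "event_prob S n F (upper_set T x)
        \<le> event_prob S n F {y \<in> samples S n. B y > ereal (mean S F)}"
      by (intro event_prob_mono) (simp_all add: finite_samples assms(1))
    also have "\<dots> \<le> \<alpha>" using assms(3) F(1) by (auto simp: valid_bound_def)
    finally show False using F(2) by simp
  qed
  then show ?thesis
    using assms(5) by (auto simp: buehler_bound_def intro!: INF_greatest)
qed

lemma cond_optimal_buehler_bound:
  assumes "finite S" and "0 < \<alpha>" and "T \<in> total_orders S n"
  shows "cond_optimal S n \<alpha> T (buehler_bound S n \<alpha> T)"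
  unfolding cond_optimal_def
proof (intro conjI allI impI)
  let ?B = "buehler_bound S n \<alpha> T"
  show valid: "valid_bound S n \<alpha> ?B" by (rule valid_buehler_bound[OF assms])
  show "consistent T ?B" by (rule consistent_buehler_bound[OF assms(3)])
  fix B' assume B': "valid_bound S n \<alpha> B' \<and> consistent T B' \<and> B' \<noteq> ?B"
  then have le: "\<forall>x\<in>samples S n. B' x \<le> ?B x"
    using valid_consistent_le_buehler_bound[OF assms(1,3)] by blast
  have "\<exists>x\<in>samples S n. B' x \<noteq> ?B x"
    using B' valid PiE_ext[of B' "samples S n" "\<lambda>_. UNIV" ?B]
    by (auto simp: valid_bound_def lower_bounds_def)
  then show "dominates S n ?B B'"
    using le unfolding dominates_def by (metis order_le_imp_less_or_eq)
qed

section \<open>Moving the zero sample to the front\<close>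

theorem lemma3p13:
  fixes S :: "real set" and n :: nat and \<alpha> :: real
  assumes "finite S" and "0 \<in> S" and "\<forall>s\<in>S. 0 \<le> s"
    and "n \<ge> 1" and "0 < \<alpha>" and "\<alpha> < 1"
  shows "(\<forall>T B. degenerate_order S n T \<and> cond_optimal S n \<alpha> T B \<longrightarrow>
            (\<exists>T' B'. T' \<in> total_orders S n \<and> T' \<noteq> T \<and>
                     cond_optimal S n \<alpha> T' B' \<and> dominates S n B' B))
       \<and> (\<forall>B. degenerate_bound S n \<alpha> B \<longrightarrow> \<not> admissible S n \<alpha> B)"
proof -
  have main: "\<exists>T' B'. T' \<in> total_orders S n \<and> T' \<noteq> T \<and>
                     cond_optimal S n \<alpha> T' B' \<and> dominates S n B' B"
    if degen: "degenerate_order S n T" and opt: "cond_optimal S n \<alpha> T B" for T B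
  proof -
    let ?z = "replicate n (0::real)"
    let ?T' = "?z # remove1 ?z T"
    let ?B' = "buehler_bound S n \<alpha> ?T'"
    have T: "distinct T" "set T = samples S n" and hd_T: "hd T \<noteq> ?z"
      using degen by (auto simp: degenerate_order_def total_orders_def)
    have valid: "valid_bound S n \<alpha> B" and cons: "sorted (map B T)"
      using opt by (auto simp: cond_optimal_def consistent_def)
    have z: "?z \<in> samples S n" by (rule zero_sample[OF assms(2)])
    have order': "?T' \<in> total_orders S n"
      using T z by (auto simp: total_orders_def)
    have opt': "cond_optimal S n \<alpha> ?T' ?B'"
      by (rule cond_optimal_buehler_bound[OF assms(1,5) order'])
    obtain x R where T_eq: "T = x # R"
      using z T(2) by (cases T) auto
    have x: "x \<in> samples S n" "x \<noteq> ?z"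
      using T_eq T(2) hd_T by auto
    have Bz: "B ?z \<le> 0"
      by (rule valid_bound_zero_sample_le[OF assms(1,2,6) valid])
    have "B x \<le> B ?z"
      using cons T_eq z x T(2) by auto
    then have Bx: "B x \<le> 0" using Bz by simp

    \<comment> \<open>A competitor for the new order that agrees with the old bound away from the zero sample.\<close>
    define B1 where "B1 = B(?z := -\<infinity>)"
    have "B1 \<in> lower_bounds S n"
      using valid z by (auto simp: B1_def valid_bound_def lower_bounds_def PiE_def extensional_def)
    then have valid1: "valid_bound S n \<alpha> B1"
      by (rule valid_bound_anti_mono[OF assms(1) valid]) (simp add: B1_def)
    have "map B1 (remove1 ?z T) = map B (remove1 ?z T)"
      using T(1) by (auto simp: B1_def)
    then have "sorted (map B1 (remove1 ?z T))"
      using sorted_map_remove1[OF cons, of ?z] by (simp only:)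
    moreover have "B1 ?z = -\<infinity>" by (simp add: B1_def)
    ultimately have "consistent ?T' B1" by (simp add: consistent_def)
    then have le1: "B1 y \<le> ?B' y" if "y \<in> samples S n" for y
      using valid_consistent_le_buehler_bound[OF assms(1) order' valid1] that by blast

    have "0 \<le> ?B' ?z"
      using z mean_nonneg[OF assms(3)] by (auto simp: buehler_bound_def intro!: INF_greatest)
    then have le: "B y \<le> ?B' y" if "y \<in> samples S n" for y
      using le1[OF that] Bz by (cases "y = ?z") (auto simp: B1_def)

    have "upper_set ?T' x \<subseteq> samples S n - {?z}"
    proof -
      have "upper_set ?T' x \<subseteq> set (remove1 ?z T)"
        using x(2) by (simp add: upper_set_def subsetI[OF set_dropWhileD])
      then show ?thesis using T by simp
    qed
    then obtain C where C: "0 < C" "\<And>F. event_prob S n F (upper_set ?T' x) \<le> C * mean S F"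
      using event_prob_le_const_times_mean[OF assms(1,3)] by blast
    have "\<alpha> / C \<le> mean S F" if "\<alpha> < event_prob S n F (upper_set ?T' x)" for F
      using that C(1) C(2)[of F] by (simp add: divide_le_eq mult.commute)
    then have "ereal (\<alpha> / C) \<le> ?B' x"
      using x(1) by (auto simp: buehler_bound_def intro!: INF_greatest)
    moreover have "0 < ereal (\<alpha> / C)" using assms(5) C(1) by simp
    ultimately have "B x < ?B' x" using Bx by (metis le_less_trans less_le_trans)
    then have "dominates S n ?B' B"
      using le x(1) by (auto simp: dominates_def)
    moreover have "?T' \<noteq> T" using hd_T by (metis list.sel(1))
    ultimately show ?thesis using order' opt' by blast
  qed
  then show ?thesis
    unfolding degenerate_bound_def admissible_def cond_optimal_def by blast
qed

end
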